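(* Let $M$ be a closed, oriented, connected smooth manifold, $c\ge2$ an integer, $\mathfrak c=c-1$, and let $\mathfrak S$ be a smooth time-dependent map into $\mathring\triangle_c$ governed by the sigma flow with $\varepsilon=0$ (i.e. with the unregularized Fisher-Rao metric $\mathfrak g$ on the target) and time-dependent domain metric $h_t=\mathcal O(\mathfrak S_t)$. If $\vartheta$ and $\mathfrak p$ denote the coordinate expressions of $\mathfrak S_t$ in $\theta$- and $p$-coordinates, respectively, then the evolution equation $\partial_t\mathfrak S_t=\tau(\mathfrak S_t;\mathfrak g,h_t)$ takes the form $$\partial_t\vartheta^i=\frac12\big(\Delta_{h_t}\vartheta^i+\mathfrak g^{ij}\Delta_{h_t}\mathfrak p_j\big),\qquad i\in[\mathfrak c],$$ and $$\partial_t\mathfrak p_i=\frac12\big(\mathfrak g_{ij}\Delta_{h_t}\vartheta^j+\Delta_{h_t}\mathfrak p_i\big),\qquad i\in[\mathfrak c].$$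
   Context: Notation: $[k]=\{1,\dots,k\}$; Einstein summation is used; $\partial_\mu$ are derivatives in local coordinates of $M$. Simplex: $\mathring\triangle_c=\{p=(p_0,\dots,p_{\mathfrak c})\in\mathbb R^c: p_i>0,\ \sum_{i=0}^{\mathfrak c}p_i=1\}$, with two global charts: $\theta$-coordinates $\theta^i=\log\frac{p_i}{p_0}$, $i\in[\mathfrak c]$, and $p$-coordinates $(p_1,\dots,p_{\mathfrak c})$. The Fisher-Rao metric in $\theta$-coordinates is $\mathfrak g_{ij}=\delta_{ij}p_i-p_ip_j$, $i,j\in[\mathfrak c]$, with inverse matrix $\mathfrak g^{ij}$ and Levi-Civita Christoffel symbols $\Gamma^i_{jk}$ in $\theta$-coordinates. Along a map into $\mathring\triangle_c$, $\mathfrak g_{ij}$ and $\mathfrak g^{ij}$ are evaluated at the value of the map. For a Riemannian metric $h$ on $M$: $\Delta_hf=\frac{1}{\sqrt{|h|}}\partial_\mu(\sqrt{|h|}h^{\mu\nu}\partial_\nu f)$. The tension field of a smooth map $\mathfrak P:(M,h)\to(\mathring\triangle_c,\mathfrak g)$ with $\theta$-coordinate functions $\vartheta^i$ is $\tau(\mathfrak P;\mathfrak g,h)=\operatorname{tr}\nabla d\mathfrak P$, i.e. in $\theta$-coordinates $\tau(\mathfrak P;\mathfrak g,h)^i=\Delta_h\vartheta^i+\Gamma^i_{jk}\,\partial_\mu\vartheta^j\,\partial_\nu\vartheta^k\,h^{\mu\nu}$. Sigma flow with $\varepsilon=0$: $\mathfrak S\in C^\infty((0,T)\times M,\mathring\triangle_c)$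 with $\partial_t\mathfrak S_t=\tau(\mathfrak S_t;\mathfrak g,h_t)$ and $h_t=\mathcal O(\mathfrak S_t)$ for $t\in(0,T)$, and given initial value $\mathfrak S_0$. Here $\mathcal O:C^\infty(M,\mathring\triangle_c)\to\Gamma(T^*M\otimes T^*M)$ takes values in Riemannian metrics on $M$ and satisfies $\mathcal O(\mathfrak P)(x)\succeq C(\mathcal O)\,\mathbb I$ for some constant $C(\mathcal O)>0$ and all $\mathfrak P$, $x$ (component matrix in the chosen coordinates of $M$). *)

theory Defs
  imports "HOL-Analysis.Analysis"
begin

section \<open>Smooth functions on open subsets of Euclidean spaces\<close>

text \<open>Both notions are meant for open domains only.\<close>

primrec Ck_on :: "nat \<Rightarrow> 'a::euclidean_space set \<Rightarrow> ('a \<Rightarrow> 'b::real_normed_vector) \<Rightarrow> bool" where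
  "Ck_on 0 V f \<longleftrightarrow> continuous_on V f"
| "Ck_on (Suc k) V f \<longleftrightarrow>
     f differentiable_on V \<and> (\<forall>b\<in>Basis. Ck_on k V (\<lambda>y. frechet_derivative f (at y) b))"

definition smooth_on :: "'a::euclidean_space set \<Rightarrow> ('a \<Rightarrow> 'b::real_normed_vector) \<Rightarrow> bool" where
  "smooth_on V f \<longleftrightarrow> (\<forall>k. Ck_on k V f)"

definition partial :: "'n::finite \<Rightarrow> (real^'n \<Rightarrow> real) \<Rightarrow> real^'n \<Rightarrow> real" where
  "partial \<mu> f y = frechet_derivative f (at y) (axis \<mu> 1)"


section \<open>Manifolds\<close>

text \<open>
  The underlying space of the manifold is a whole type. A chart is a pair of its domain and its
  coordinate map; values of the coordinate map outside the domain are irrelevant.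
\<close>

type_synonym ('a, 'm) chart = "'a set \<times> ('a \<Rightarrow> real^'m)"

abbreviation cdom :: "('a, 'm) chart \<Rightarrow> 'a set" where "cdom \<equiv> fst"
abbreviation cmap :: "('a, 'm) chart \<Rightarrow> 'a \<Rightarrow> real^'m" where "cmap \<equiv> snd"

definition cinv :: "('a, 'm) chart \<Rightarrow> real^'m \<Rightarrow> 'a" where
  "cinv c = inv_into (cdom c) (cmap c)"

definition crange :: "('a, 'm) chart \<Rightarrow> (real^'m) set" where
  "crange c = cmap c ` cdom c"

definition is_chart :: "('a::topological_space, 'm::finite) chart \<Rightarrow> bool" where
  "is_chart c \<longleftrightarrow> open (cdom c) \<and> open (crange c)
     \<and> homeomorphism (cdom c) (crange c) (cmap c) (cinv c)"

definition transition_smooth :: "('a, 'm::finite) chart \<Rightarrow> ('a, 'm) chart \<Rightarrow> bool" where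
  "transition_smooth c d \<longleftrightarrow> smooth_on (cmap c ` (cdom c \<inter> cdom d)) (cmap d \<circ> cinv c)"

definition transition_jacobian ::
    "('a, 'm::finite) chart \<Rightarrow> ('a, 'm) chart \<Rightarrow> 'a \<Rightarrow> real^'m^'m" where
  "transition_jacobian c d x = matrix (frechet_derivative (cmap d \<circ> cinv c) (at (cmap c x)))"

definition smooth_atlas :: "('a::topological_space, 'm::finite) chart set \<Rightarrow> bool" where
  "smooth_atlas A \<longleftrightarrow> (\<forall>c\<in>A. is_chart c) \<and> (\<Union>c\<in>A. cdom c) = UNIV
     \<and> (\<forall>c\<in>A. \<forall>d\<in>A. transition_smooth c d)"

definition oriented_atlas :: "('a::topological_space, 'm::finite) chart set \<Rightarrow> bool" where
  "oriented_atlas A \<longleftrightarrow> smooth_atlas A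
     \<and> (\<forall>c\<in>A. \<forall>d\<in>A. \<forall>x\<in>cdom c \<inter> cdom d. det (transition_jacobian c d x) > 0)"

text \<open>The maximal atlas generated by \<open>A\<close>; its charts need not preserve the orientation.\<close>

definition local_coords ::
    "('a::topological_space, 'm::finite) chart set \<Rightarrow> ('a, 'm) chart set" where
  "local_coords A =
     {c. is_chart c \<and> (\<forall>d\<in>A. transition_smooth c d \<and> transition_smooth d c)}"

text \<open>
  The Hausdorff property and second countability are carried by the type class; closed means
  compact, the boundary being empty because charts have open range in \<open>real^'m\<close>.
\<close>

definition closed_oriented_connected_manifold ::
    "('a::{t2_space,second_countable_topology}, 'm::finite) chart set \<Rightarrow> bool" where
  "closed_oriented_connected_manifold A \<longleftrightarrow>
     oriented_atlas A \<and> compact (UNIV :: 'a set) \<and> connected (UNIV :: 'a set)"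


section \<open>Riemannian metrics and the Laplace-Beltrami operator\<close>

text \<open>
  A covariant 2-tensor field is given by its component matrices \<open>h c x\<close> at the point \<open>x\<close> in
  each local coordinate system \<open>c\<close> around \<open>x\<close>, subject to the transformation law.
\<close>

type_synonym ('a, 'm) tensor2 = "('a, 'm) chart \<Rightarrow> 'a \<Rightarrow> real^'m^'m"

definition smooth_tensor2 ::
    "('a::topological_space, 'm::finite) chart set \<Rightarrow> ('a, 'm) tensor2 \<Rightarrow> bool" where
  "smooth_tensor2 A h \<longleftrightarrow>
     (\<forall>c\<in>local_coords A. smooth_on (crange c) (h c \<circ> cinv c))
   \<and> (\<forall>c\<in>local_coords A. \<forall>d\<in>local_coords A. \<forall>x\<in>cdom c \<inter> cdom d.
        h c x = transpose (transition_jacobian c d x) ** h d x ** transition_jacobian c d x)"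

definition riemannian_metric ::
    "('a::topological_space, 'm::finite) chart set \<Rightarrow> ('a, 'm) tensor2 \<Rightarrow> bool" where
  "riemannian_metric A h \<longleftrightarrow> smooth_tensor2 A h
     \<and> (\<forall>c\<in>local_coords A. \<forall>x\<in>cdom c. transpose (h c x) = h c x
          \<and> (\<forall>v. v \<noteq> 0 \<longrightarrow> v \<bullet> (h c x *v v) > 0))"

definition laplace_beltrami ::
    "('a, 'm::finite) chart \<Rightarrow> ('a, 'm) tensor2 \<Rightarrow> ('a \<Rightarrow> real) \<Rightarrow> 'a \<Rightarrow> real" where
  "laplace_beltrami c h f x =
     (let H = h c \<circ> cinv c; F = f \<circ> cinv c; y = cmap c x in
      1 / sqrt (det (H y)) *
      (\<Sum>\<mu>\<in>UNIV. partial \<mu>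
         (\<lambda>z. \<Sum>\<nu>\<in>UNIV. sqrt (det (H z)) * matrix_inv (H z) $ \<mu> $ \<nu> * partial \<nu> F z) y))"


section \<open>The open probability simplex with the Fisher-Rao metric\<close>

text \<open>
  The index set \<open>{0, \<dots>, c - 1}\<close> is rendered as \<open>'k option\<close>: \<open>None\<close> is the index 0 and
  \<open>Some i\<close> ranges over \<open>{1, \<dots>, c - 1}\<close>. Since \<open>'k\<close> is nonempty, \<open>c = CARD('k) + 1\<close> is an
  arbitrary integer \<open>\<ge> 2\<close>.
\<close>

definition simplex_interior :: "(real^('k::finite option)) set" where
  "simplex_interior = {p. (\<forall>i. p $ i > 0) \<and> (\<Sum>i\<in>UNIV. p $ i) = 1}"

definition theta_coord :: "real^('k::finite option) \<Rightarrow> real^'k" where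
  "theta_coord p = (\<chi> i. ln (p $ Some i / p $ None))"

definition p_coord :: "real^('k::finite option) \<Rightarrow> real^'k" where
  "p_coord p = (\<chi> i. p $ Some i)"

definition of_theta :: "real^'k::finite \<Rightarrow> real^('k option)" where
  "of_theta \<theta> = (\<chi> i. (case i of None \<Rightarrow> 1 | Some j \<Rightarrow> exp (\<theta> $ j)) / (1 + (\<Sum>l\<in>UNIV. exp (\<theta> $ l))))"

lemma sum_option_UNIV:
  fixes f :: "'k::finite option \<Rightarrow> real"
  shows "(\<Sum>i\<in>UNIV. f i) = f None + (\<Sum>j\<in>UNIV. f (Some j))"
  by (simp add: UNIV_option_conv sum.reindex)

lemma of_theta_theta_coord:
  fixes p :: "real^('k::finite option)"
  assumes "p \<in> simplex_interior"
  shows "of_theta (theta_coord p) = p"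
proof -
  have pos: "p $ i > 0" for i
    using assms by (simp add: simplex_interior_def)
  have "p $ None + (\<Sum>l\<in>UNIV. p $ Some l) = 1"
    using assms by (simp add: simplex_interior_def sum_option_UNIV)
  then have "1 + (\<Sum>l\<in>UNIV. p $ Some l / p $ None) = 1 / p $ None"
    using pos[of None] by (simp add: sum_divide_distrib[symmetric] field_simps)
  moreover have "exp (theta_coord p $ l) = p $ Some l / p $ None" for l
    using pos by (simp add: theta_coord_def)
  ultimately show ?thesis
    using pos[of None]
    by (auto simp: of_theta_def vec_eq_iff split: option.split)
qed

lemma of_theta_in_simplex: "of_theta \<theta> \<in> simplex_interior"
proof -
  have s: "1 + (\<Sum>l\<in>UNIV. exp (\<theta> $ l)) > 0"
    by (intro add_pos_nonneg sum_nonneg) auto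
  then show ?thesis
    by (auto simp: of_theta_def simplex_interior_def sum_option_UNIV
        add_divide_distrib[symmetric] sum_divide_distrib[symmetric] split: option.split)
qed

lemma theta_coord_of_theta: "theta_coord (of_theta \<theta>) = \<theta>"
proof -
  have "1 + (\<Sum>l\<in>UNIV. exp (\<theta> $ l)) > 0"
    by (intro add_pos_nonneg sum_nonneg) auto
  then show ?thesis
    by (auto simp: of_theta_def theta_coord_def vec_eq_iff)
qed

text \<open>Components of the Fisher-Rao metric in \<open>\<theta>\<close>-coordinates, as a function of the base point.\<close>

definition fisher_rao :: "real^('k::finite option) \<Rightarrow> real^'k^'k" where
  "fisher_rao p = (\<chi> i j. (if i = j then p $ Some i else 0) - p $ Some i * p $ Some j)"

definition christoffel :: "'k::finite \<Rightarrow> 'k \<Rightarrow> 'k \<Rightarrow> real^('k option) \<Rightarrow> real" where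
  "christoffel i j k p =
     (let G = (\<lambda>\<theta>. fisher_rao (of_theta \<theta>)); \<theta> = theta_coord p in
      (\<Sum>l\<in>UNIV. 1/2 * matrix_inv (G \<theta>) $ i $ l *
         (partial j (\<lambda>\<eta>. G \<eta> $ l $ k) \<theta> + partial k (\<lambda>\<eta>. G \<eta> $ l $ j) \<theta>
            - partial l (\<lambda>\<eta>. G \<eta> $ j $ k) \<theta>)))"


section \<open>The sigma flow\<close>

text \<open>Smoothness of maps into the simplex is tested in the global \<open>\<theta>\<close>-chart.\<close>

definition smooth_maps ::
    "('a::topological_space, 'm::finite) chart set \<Rightarrow> ('a \<Rightarrow> real^('k::finite option)) set" where
  "smooth_maps A = {P. (\<forall>x. P x \<in> simplex_interior)
     \<and> (\<forall>c\<in>local_coords A. smooth_on (crange c) (\<lambda>y. theta_coord (P (cinv c y))))}"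

definition smooth_time_maps ::
    "('a::topological_space, 'm::finite) chart set \<Rightarrow> real
       \<Rightarrow> (real \<Rightarrow> 'a \<Rightarrow> real^('k::finite option)) set" where
  "smooth_time_maps A T = {S. (\<forall>t\<in>{0<..<T}. \<forall>x. S t x \<in> simplex_interior)
     \<and> (\<forall>c\<in>local_coords A.
          smooth_on ({0<..<T} \<times> crange c) (\<lambda>(t, y). theta_coord (S t (cinv c y))))}"

text \<open>
  The uniform lower bound refers to the components in the chosen charts \<open>A\<close>; over all local
  coordinates it could never hold, because coordinates can be rescaled.
\<close>

definition admissible_metric_operator ::
    "('a::topological_space, 'm::finite) chart set
       \<Rightarrow> (('a \<Rightarrow> real^('k::finite option)) \<Rightarrow> ('a, 'm) tensor2) \<Rightarrow> bool" where
  "admissible_metric_operator A Op \<longleftrightarrow>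
     (\<forall>P\<in>smooth_maps A. riemannian_metric A (Op P))
   \<and> (\<exists>C>0. \<forall>P\<in>smooth_maps A. \<forall>c\<in>A. \<forall>x\<in>cdom c. \<forall>v.
        v \<bullet> (Op P c x *v v) \<ge> C * (v \<bullet> v))"

text \<open>The \<open>\<theta>\<close>-components of the tension field, computed in the local coordinates \<open>c\<close>.\<close>

definition tension ::
    "('a, 'm::finite) chart \<Rightarrow> ('a, 'm) tensor2 \<Rightarrow> ('a \<Rightarrow> real^('k::finite option)) \<Rightarrow> 'a
       \<Rightarrow> real^'k" where
  "tension c h P x = (\<chi> i.
     laplace_beltrami c h (\<lambda>z. theta_coord (P z) $ i) x
     + (\<Sum>j\<in>UNIV. \<Sum>k\<in>UNIV. \<Sum>\<mu>\<in>UNIV. \<Sum>\<nu>\<in>UNIV. christoffel i j k (P x)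
          * partial \<mu> (\<lambda>y. theta_coord (P (cinv c y)) $ j) (cmap c x)
          * partial \<nu> (\<lambda>y. theta_coord (P (cinv c y)) $ k) (cmap c x)
          * matrix_inv (h c x) $ \<mu> $ \<nu>))"

text \<open>
  The equation between vector fields along \<open>S t\<close> is the equality of their \<open>\<theta>\<close>-components.
\<close>

definition sigma_flow_equation ::
    "('a::topological_space, 'm::finite) chart set
       \<Rightarrow> (('a \<Rightarrow> real^('k::finite option)) \<Rightarrow> ('a, 'm) tensor2)
       \<Rightarrow> real \<Rightarrow> (real \<Rightarrow> 'a \<Rightarrow> real^('k option)) \<Rightarrow> bool" where
  "sigma_flow_equation A Op T S \<longleftrightarrow>
     (\<forall>t\<in>{0<..<T}. \<forall>c\<in>local_coords A. \<forall>x\<in>cdom c. \<forall>i.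
        ((\<lambda>s. theta_coord (S s x) $ i) has_real_derivative tension c (Op (S t)) (S t) x $ i) (at t))"

text \<open>The initial value is attained as a pointwise limit, which is the weakest sensible reading.\<close>

definition has_initial_value ::
    "(real \<Rightarrow> 'a \<Rightarrow> real^('k::finite option)) \<Rightarrow> ('a \<Rightarrow> real^('k option)) \<Rightarrow> bool" where
  "has_initial_value S S0 \<longleftrightarrow> (\<forall>x. S0 x \<in> simplex_interior \<and> ((\<lambda>t. S t x) \<longlongrightarrow> S0 x) (at_right 0))"

end

theory Submission
  imports Defs
begin

text \<open>
  In \<open>\<theta>\<close>-coordinates the Fisher-Rao metric is a Hessian metric: \<open>g\<close> is the Jacobian of the
  coordinate change \<open>\<theta> \<mapsto> p\<close>, that is \<open>\<partial>p\<^sub>j / \<partial>\<theta>\<^sup>l = g\<^sub>j\<^sub>l\<close>, and its derivative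
  \<open>C\<^sub>j\<^sub>k\<^sub>l = \<partial>g\<^sub>j\<^sub>k / \<partial>\<theta>\<^sup>l\<close> is symmetric in all three indices. These two facts are
  \<open>of_theta_has_derivative\<close> and \<open>fisher_rao_has_derivative\<close>.

  The symmetry makes the three derivatives in the Christoffel symbol equal, so that
  \<open>\<Gamma>\<^sup>i\<^sub>j\<^sub>k = 1/2 g\<^sup>i\<^sup>l C\<^sub>l\<^sub>j\<^sub>k\<close> (\<open>christoffel_amari_chentsov\<close>). On the other hand, the chain
  rule for the Laplace-Beltrami operator (\<open>laplace_beltrami_compose\<close>), applied to \<open>p\<^sub>l\<close> as a
  function of \<open>\<theta>\<close>, gives
  \<open>\<Delta> p\<^sub>l = g\<^sub>l\<^sub>k \<Delta> \<theta>\<^sup>k + C\<^sub>l\<^sub>j\<^sub>k \<partial>\<^sub>\<mu> \<theta>\<^sup>j \<partial>\<^sub>\<nu> \<theta>\<^sup>k h\<^sup>\<mu>\<^sup>\<nu>\<close>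
  (\<open>laplace_beltrami_p_coord\<close>). The quadratic term of the tension field is therefore
  \<open>1/2 g\<^sup>i\<^sup>l (\<Delta> p\<^sub>l - g\<^sub>l\<^sub>k \<Delta> \<theta>\<^sup>k)\<close>, and the tension field itself is
  \<open>1/2 (\<Delta> \<theta>\<^sup>i + g\<^sup>i\<^sup>l \<Delta> p\<^sub>l)\<close> (\<open>tension_eq_half_laplacians\<close>). This is the equation for \<open>\<theta>\<close>.

  The equation for \<open>p\<close> is the same velocity in the other chart: the Jacobian \<open>g\<close> is invertible,
  so a curve has \<open>\<theta>\<close>-velocity \<open>D\<close> if and only if it has \<open>p\<close>-velocity \<open>g D\<close>
  (\<open>velocity_theta_iff_p\<close>).
\<close>


section \<open>Partial derivatives and smooth functions\<close>

lemma has_derivative_imp_partial: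
  assumes "(f has_derivative f') (at y)"
  shows "partial \<mu> f y = f' (axis \<mu> 1)"
  using frechet_derivative_at[OF assms] by (simp add: partial_def)

lemma partial_transform_open:
  assumes "open V" "y \<in> V" "\<And>z. z \<in> V \<Longrightarrow> f z = g z"
  shows "partial \<mu> f y = partial \<mu> g y"
proof -
  have "(f has_derivative D) (at y) \<longleftrightarrow> (g has_derivative D) (at y)" for D
    using has_derivative_transform_within_open[OF _ assms(1,2)] assms(3) by metis
  then show ?thesis
    by (simp add: partial_def frechet_derivative_def)
qed

lemma Ck_on_cong_open:
  fixes f g :: "'a::euclidean_space \<Rightarrow> 'b::real_normed_vector"
  assumes "open V" "\<And>z. z \<in> V \<Longrightarrow> f z = g z" "Ck_on k V f"
  shows "Ck_on k V g"
  using assms(2,3)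
proof (induction k arbitrary: f g)
  case 0
  then show ?case using continuous_on_cong[of V V f g] by simp
next
  case (Suc k)
  have "frechet_derivative f (at z) = frechet_derivative g (at z)" if "z \<in> V" for z
  proof -
    have "f differentiable at z"
      using Suc.prems(2) that assms(1) by (simp add: differentiable_on_eq_differentiable_at)
    then show ?thesis
      using frechet_derivative_transform_within_open[of f z V g] that assms(1) Suc.prems(1) by blast
  qed
  moreover have "g differentiable_on V"
    using Suc.prems unfolding Ck_on.simps
    by (metis differentiable_on_def differentiable_transform_within zero_less_one)
  moreover have "Ck_on k V (\<lambda>y. frechet_derivative g (at y) b)" if "b \<in> Basis" for b
    by (rule Suc.IH[of "\<lambda>y. frechet_derivative f (at y) b"])
      (use calculation Suc.prems(2) that in auto)
  ultimately show ?case
    by simp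
qed

text \<open>
  Freezing the time variable of a smooth time-dependent map leaves a map that is smooth on the
  manifold; this is what allows the metric operator to be applied at each time.
\<close>

lemma Ck_on_slice:
  fixes f :: "'a::euclidean_space \<times> 'b::euclidean_space \<Rightarrow> 'c::real_normed_vector"
  assumes "open U" "open V" "t \<in> U" "Ck_on k (U \<times> V) f"
  shows "Ck_on k V (\<lambda>y. f (t, y))"
  using assms(4)
proof (induction k arbitrary: f)
  case 0
  then show ?case
    using assms(3) continuous_on_compose2[of "U \<times> V" f V "\<lambda>y. (t, y)"]
    by (simp add: continuous_on_Pair image_subset_iff)
next
  case (Suc k)
  have der: "((\<lambda>y. f (t, y)) has_derivative (\<lambda>v. frechet_derivative f (at (t, y)) (0, v))) (at y)"
    if "y \<in> V" for y
  proof -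
    have "f differentiable at (t, y)"
      using Suc.prems that assms
      by (simp add: differentiable_on_eq_differentiable_at open_Times)
    then have "(f has_derivative frechet_derivative f (at (t, y))) (at (t, y))"
      by (simp add: frechet_derivative_works)
    then show ?thesis
      by (rule has_derivative_compose[OF has_derivative_Pair[OF has_derivative_const has_derivative_ident]])
  qed
  have "Ck_on k V (\<lambda>y. frechet_derivative (\<lambda>y. f (t, y)) (at y) b)" if "b \<in> Basis" for b
  proof (rule Ck_on_cong_open[OF \<open>open V\<close>])
    show "Ck_on k V (\<lambda>y. frechet_derivative f (at (t, y)) (0, b))"
      using Suc.IH[of "\<lambda>z. frechet_derivative f (at z) (0, b)"] Suc.prems that
      by (simp add: Basis_prod_def)
  next
    fix y assume "y \<in> V"
    then show "frechet_derivative f (at (t, y)) (0, b) = frechet_derivative (\<lambda>y. f (t, y)) (at y) b"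
      using frechet_derivative_at[OF der] by metis
  qed
  moreover have "(\<lambda>y. f (t, y)) differentiable_on V"
    using der assms(2) by (auto simp: differentiable_on_eq_differentiable_at differentiable_def)
  ultimately show ?case by simp
qed

lemma has_derivative_vec:
  fixes f :: "'n::finite \<Rightarrow> 'a::real_normed_vector \<Rightarrow> real"
  assumes "\<And>i. (f i has_derivative f' i) F"
  shows "((\<lambda>z. \<chi> i. f i z) has_derivative (\<lambda>v. \<chi> i. f' i v)) F"
proof -
  have "((\<lambda>z. \<Sum>i\<in>UNIV. f i z *\<^sub>R axis i 1 :: real^'n) has_derivative (\<lambda>v. \<Sum>i\<in>UNIV. f' i v *\<^sub>R axis i 1)) F"
    by (intro has_derivative_sum has_derivative_scaleR_left assms)
  moreover have "(\<Sum>i\<in>UNIV. g i *\<^sub>R axis i 1 :: real^'n) = (\<chi> i. g i)" for g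
    by (simp add: vec_eq_iff axis_def if_distrib[of "\<lambda>x. _ * x"] cong: if_cong)
  ultimately show ?thesis by simp
qed

lemma differentiable_vec_nth:
  assumes "f differentiable (at y)"
  shows "(\<lambda>z. f z $ i) differentiable (at y)"
  using assms bounded_linear.has_derivative[OF bounded_linear_vec_nth]
  unfolding differentiable_def by metis

lemma smooth_on_differentiable:
  assumes "smooth_on R f" "open R" "y \<in> R"
  shows "f differentiable (at y)"
proof -
  have "Ck_on (Suc 0) R f"
    using assms(1) by (simp only: smooth_on_def)
  then show ?thesis
    using assms(2,3) by (simp add: differentiable_on_eq_differentiable_at)
qed

lemma smooth_on_partial_differentiable:
  fixes f :: "real^'m::finite \<Rightarrow> real^'k::finite"
  assumes "smooth_on R f" "open R" "y \<in> R"
  shows "partial \<nu> (\<lambda>z. f z $ k) differentiable (at y)"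
proof -
  have "Ck_on (Suc (Suc 0)) R f"
    using assms(1) by (simp only: smooth_on_def)
  then have "(\<lambda>z. frechet_derivative f (at z) (axis \<nu> 1)) differentiable (at y)"
    using assms(2,3) by (simp add: differentiable_on_eq_differentiable_at axis_in_Basis_iff)
  then have "(\<lambda>z. frechet_derivative f (at z) (axis \<nu> 1) $ k) differentiable (at y)"
    by (rule differentiable_vec_nth)
  then obtain D where D: "((\<lambda>z. frechet_derivative f (at z) (axis \<nu> 1) $ k) has_derivative D) (at y)"
    by (auto simp: differentiable_def)
  have "partial \<nu> (\<lambda>z. f z $ k) z = frechet_derivative f (at z) (axis \<nu> 1) $ k" if "z \<in> R" for z
    using smooth_on_differentiable[OF assms(1,2) that]
    by (intro has_derivative_imp_partial bounded_linear.has_derivative[OF bounded_linear_vec_nth])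
      (simp add: frechet_derivative_works)
  then have "(partial \<nu> (\<lambda>z. f z $ k) has_derivative D) (at y)"
    by (intro has_derivative_transform_within_open[OF D assms(2,3)]) simp
  then show ?thesis
    by (auto simp: differentiable_def)
qed


section \<open>Inverse and volume density of a matrix field\<close>

lemma differentiable_det:
  fixes B :: "'a::real_normed_vector \<Rightarrow> real^'n^'n::finite"
  assumes "\<And>i j. (\<lambda>z. B z $ i $ j) differentiable (at y)"
  shows "(\<lambda>z. det (B z)) differentiable (at y)"
proof -
  have "(\<lambda>z. \<Prod>i\<in>UNIV. B z $ i $ p i) differentiable (at y)" for p
    unfolding differentiable_def
    by (rule exI, rule has_derivative_prod, rule assms[unfolded frechet_derivative_works])
  then show ?thesis
    unfolding det_def by (intro differentiable_sum differentiable_mult) auto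
qed

lemma matrix_inv_inverse:
  fixes B :: "real^'n^'n::finite"
  assumes "invertible B"
  shows "B ** matrix_inv B = mat 1" "matrix_inv B ** B = mat 1"
  using someI_ex[OF assms[unfolded invertible_def]] by (simp_all add: matrix_inv_def)

text \<open>
  Cramer's rule for the columns of the inverse. It writes each entry as a quotient of determinants,
  which turns differentiability of the inverse into differentiability of determinants.
\<close>

lemma matrix_inv_component:
  fixes B :: "real^'n^'n::finite"
  assumes "det B \<noteq> 0"
  shows "matrix_inv B $ \<mu> $ \<nu> = det (\<chi> i j. if j = \<mu> then axis \<nu> 1 $ i else B $ i $ j) / det B"
proof -
  have "B *v (matrix_inv B *v axis \<nu> 1) = axis \<nu> 1"
    using assms by (simp add: matrix_vector_mul_assoc matrix_inv_inverse invertible_det_nz)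
  then have "matrix_inv B *v axis \<nu> 1
      = (\<chi> k. det (\<chi> i j. if j = k then axis \<nu> 1 $ i else B $ i $ j) / det B)"
    using cramer[OF assms] by blast
  then have "(matrix_inv B *v axis \<nu> 1) $ \<mu>
      = det (\<chi> i j. if j = \<mu> then axis \<nu> 1 $ i else B $ i $ j) / det B"
    by simp
  then show ?thesis
    by (simp add: matrix_vector_mul_component inner_axis row_def matrix_vector_mult_basis column_def)
qed

lemma differentiable_matrix_inv:
  fixes B :: "'a::real_normed_vector \<Rightarrow> real^'n^'n::finite"
  assumes "\<And>i j. (\<lambda>z. B z $ i $ j) differentiable (at y)"
    and "open V" "y \<in> V" "\<And>z. z \<in> V \<Longrightarrow> det (B z) \<noteq> 0"
  shows "(\<lambda>z. matrix_inv (B z) $ \<mu> $ \<nu>) differentiable (at y)"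
proof -
  have "(\<lambda>z. (\<chi> i j. if j = \<mu> then axis \<nu> 1 $ i else B z $ i $ j) $ i $ j) differentiable (at y)" for i j
    using assms(1) by (cases "j = \<mu>") auto
  then have "(\<lambda>z. det (\<chi> i j. if j = \<mu> then axis \<nu> 1 $ i else B z $ i $ j) / det (B z)) differentiable (at y)"
    by (intro differentiable_divide differentiable_det assms) (use assms in auto)
  then obtain D where "((\<lambda>z. det (\<chi> i j. if j = \<mu> then axis \<nu> 1 $ i else B z $ i $ j) / det (B z))
      has_derivative D) (at y)"
    by (auto simp: differentiable_def)
  then have "((\<lambda>z. matrix_inv (B z) $ \<mu> $ \<nu>) has_derivative D) (at y)"
    by (rule has_derivative_transform_within_open[OF _ assms(2,3)])
      (simp add: matrix_inv_component assms(4))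
  then show ?thesis
    by (auto simp: differentiable_def)
qed

lemma pos_def_det_nonzero:
  fixes B :: "real^'n^'n::finite"
  assumes "\<And>v. v \<noteq> 0 \<Longrightarrow> v \<bullet> (B *v v) > 0"
  shows "det B \<noteq> 0"
proof -
  have "v = 0" if "B *v v = 0" for v
    using assms[of v] that by (metis inner_zero_right less_irrefl)
  then show ?thesis
    unfolding invertible_det_nz[symmetric] invertible_left_inverse matrix_left_invertible_ker
    by blast
qed

text \<open>
  These are the coefficients of the flux whose divergence is the Laplace-Beltrami operator. The
  real square root is continued to the negative axis as an odd function, so 0 is the only point
  where it fails to be differentiable.
\<close>

lemma differentiable_volume_inverse:
  fixes B :: "'a::real_normed_vector \<Rightarrow> real^'n^'n::finite"
  assumes "\<And>i j. (\<lambda>z. B z $ i $ j) differentiable (at y)"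
    and "open V" "y \<in> V" "\<And>z. z \<in> V \<Longrightarrow> det (B z) \<noteq> 0"
  shows "(\<lambda>z. sqrt (det (B z)) * matrix_inv (B z) $ \<mu> $ \<nu>) differentiable (at y)"
proof -
  have "sqrt differentiable (at (det (B y)))"
    using assms(4)[OF assms(3)]
      DERIV_real_sqrt_generic[of "det (B y)"
        "if det (B y) > 0 then inverse (sqrt (det (B y))) / 2 else - inverse (sqrt (det (B y))) / 2"]
    by (auto simp: real_differentiable_def)
  then have "(\<lambda>z. sqrt (det (B z))) differentiable (at y)"
    by (rule differentiable_compose) (rule differentiable_det[OF assms(1)])
  then show ?thesis
    using differentiable_matrix_inv[OF assms] by (intro differentiable_mult)
qed


section \<open>The chain rule for the Laplace-Beltrami operator\<close>

text \<open>
  The flux of the composition is \<open>\<Sum>\<^sub>k \<partial>\<^sub>k\<phi>(u) F\<^sub>k\<close>, where \<open>F\<^sub>k\<close> is the flux of \<open>u\<^sub>k\<close>. In its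
  divergence the derivative falls either on \<open>F\<^sub>k\<close>, which yields \<open>\<Delta> u\<^sub>k\<close>, or on \<open>\<partial>\<^sub>k\<phi>(u)\<close>, which
  yields the term quadratic in the gradients.
\<close>

lemma laplace_beltrami_compose:
  fixes u :: "'k::finite \<Rightarrow> 'a \<Rightarrow> real" and c :: "('a, 'm::finite) chart"
  defines "V k y \<equiv> u k (cinv c y)"
  assumes V: "open Y" "cmap c x \<in> Y"
    and dV: "\<And>k z. z \<in> Y \<Longrightarrow> V k differentiable (at z)"
    and ddV: "\<And>k \<nu>. partial \<nu> (V k) differentiable (at (cmap c x))"
    and W: "\<And>\<mu> \<nu>. (\<lambda>z. sqrt (det (h c (cinv c z))) * matrix_inv (h c (cinv c z)) $ \<mu> $ \<nu>)
              differentiable (at (cmap c x))"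
    and nz: "det (h c (cinv c (cmap c x))) \<noteq> 0"
    and \<phi>: "\<And>\<eta>. (\<phi> has_derivative (\<lambda>v. \<Sum>k\<in>UNIV. d\<phi> k \<eta> * v $ k)) (at \<eta>)"
    and d\<phi>: "\<And>k \<eta>. (d\<phi> k has_derivative (\<lambda>v. \<Sum>l\<in>UNIV. dd\<phi> k l \<eta> * v $ l)) (at \<eta>)"
    and \<eta>: "\<eta> = (\<chi> k. V k (cmap c x))"
  shows "laplace_beltrami c h (\<lambda>z. \<phi> (\<chi> k. u k z)) x
    = (\<Sum>k\<in>UNIV. d\<phi> k \<eta> * laplace_beltrami c h (u k) x)
      + (\<Sum>k\<in>UNIV. \<Sum>l\<in>UNIV. \<Sum>\<mu>\<in>UNIV. \<Sum>\<nu>\<in>UNIV. dd\<phi> k l \<eta>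
          * partial \<mu> (V l) (cmap c x) * partial \<nu> (V k) (cmap c x)
          * matrix_inv (h c (cinv c (cmap c x))) $ \<mu> $ \<nu>)"
proof -
  define y where "y = cmap c x"
  define w where "w z = sqrt (det (h c (cinv c z)))" for z
  define Hi where "Hi \<mu> \<nu> z = matrix_inv (h c (cinv c z)) $ \<mu> $ \<nu>" for \<mu> \<nu> z
  define F where "F k \<mu> z = (\<Sum>\<nu>\<in>UNIV. w z * Hi \<mu> \<nu> z * partial \<nu> (V k) z)" for k \<mu> z
  have LBu: "laplace_beltrami c h (u k) x = 1 / w y * (\<Sum>\<mu>\<in>UNIV. partial \<mu> (F k \<mu>) y)" for k
    by (simp add: laplace_beltrami_def Let_def F_def[abs_def] w_def Hi_def y_def V_def[abs_def] o_def[abs_def])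
  have hV: "((\<lambda>z. \<chi> k. V k z) has_derivative (\<lambda>v. \<chi> k. frechet_derivative (V k) (at z) v)) (at z)"
    if "z \<in> Y" for z
    by (rule has_derivative_vec) (use dV[OF that] frechet_derivative_works in blast)
  have comp: "((\<lambda>z. g (\<chi> k. V k z)) has_derivative
      (\<lambda>v. \<Sum>k\<in>UNIV. dg k * frechet_derivative (V k) (at z) v)) (at z)"
    if "z \<in> Y" "(g has_derivative (\<lambda>v. \<Sum>k\<in>UNIV. dg k * v $ k)) (at (\<chi> k. V k z))"
    for g :: "real^'k \<Rightarrow> real" and dg z
    using has_derivative_compose[OF hV[OF that(1)] that(2)] by simp
  have grad: "partial \<nu> (\<lambda>z. \<phi> (\<chi> k. V k z)) z = (\<Sum>k\<in>UNIV. d\<phi> k (\<chi> k. V k z) * partial \<nu> (V k) z)"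
    if "z \<in> Y" for \<nu> z
    using has_derivative_imp_partial[OF comp[OF that \<phi>]] by (simp add: partial_def)
  \<comment> \<open>This holds in a neighbourhood of the point, and can therefore be differentiated there.\<close>
  have flux: "(\<Sum>\<nu>\<in>UNIV. w z * Hi \<mu> \<nu> z * partial \<nu> (\<lambda>z. \<phi> (\<chi> k. V k z)) z)
      = (\<Sum>k\<in>UNIV. d\<phi> k (\<chi> k. V k z) * F k \<mu> z)" if "z \<in> Y" for \<mu> z
    unfolding grad[OF that] F_def sum_distrib_left
    by (subst sum.swap) (simp add: mult_ac)
  have dF: "F k \<mu> differentiable (at y)" for k \<mu>
    unfolding F_def[abs_def] using W ddV
    by (intro differentiable_sum differentiable_mult) (auto simp: w_def Hi_def y_def)
  have div: "partial \<mu> (\<lambda>z. \<Sum>\<nu>\<in>UNIV. w z * Hi \<mu> \<nu> z * partial \<nu> (\<lambda>z. \<phi> (\<chi> k. V k z)) z) y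
      = (\<Sum>k\<in>UNIV. d\<phi> k \<eta> * partial \<mu> (F k \<mu>) y
          + (\<Sum>l\<in>UNIV. dd\<phi> k l \<eta> * partial \<mu> (V l) y) * F k \<mu> y)" for \<mu>
  proof -
    have "partial \<mu> (\<lambda>z. \<Sum>\<nu>\<in>UNIV. w z * Hi \<mu> \<nu> z * partial \<nu> (\<lambda>z. \<phi> (\<chi> k. V k z)) z) y
      = partial \<mu> (\<lambda>z. \<Sum>k\<in>UNIV. d\<phi> k (\<chi> k. V k z) * F k \<mu> z) y"
      using V flux by (intro partial_transform_open[of Y]) (auto simp: y_def)
    moreover have "((\<lambda>z. \<Sum>k\<in>UNIV. d\<phi> k (\<chi> k. V k z) * F k \<mu> z) has_derivative
        (\<lambda>v. \<Sum>k\<in>UNIV. d\<phi> k (\<chi> k. V k y) * frechet_derivative (F k \<mu>) (at y) v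
           + (\<Sum>l\<in>UNIV. dd\<phi> k l (\<chi> k. V k y) * frechet_derivative (V l) (at y) v) * F k \<mu> y)) (at y)"
      using V(2) dF[unfolded frechet_derivative_works]
      by (intro has_derivative_sum has_derivative_mult comp d\<phi>) (auto simp: y_def)
    ultimately show ?thesis
      using has_derivative_imp_partial by (fastforce simp: partial_def \<eta> y_def)
  qed
  have wy: "w y \<noteq> 0" using nz by (simp add: w_def y_def)
  have "laplace_beltrami c h (\<lambda>z. \<phi> (\<chi> k. u k z)) x
      = 1 / w y * (\<Sum>\<mu>\<in>UNIV. partial \<mu> (\<lambda>z. \<Sum>\<nu>\<in>UNIV. w z * Hi \<mu> \<nu> z *
            partial \<nu> (\<lambda>z. \<phi> (\<chi> k. V k z)) z) y)"
    by (simp add: laplace_beltrami_def Let_def w_def Hi_def y_def V_def[abs_def] o_def[abs_def])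
  also have "\<dots> = (\<Sum>k\<in>UNIV. d\<phi> k \<eta> * (1 / w y * (\<Sum>\<mu>\<in>UNIV. partial \<mu> (F k \<mu>) y)))
      + (\<Sum>k\<in>UNIV. \<Sum>\<mu>\<in>UNIV. (\<Sum>l\<in>UNIV. dd\<phi> k l \<eta> * partial \<mu> (V l) y) * (F k \<mu> y / w y))"
    unfolding div by (subst sum.swap) (simp add: sum.distrib sum_distrib_left distrib_left sum_divide_distrib mult_ac add_divide_distrib)
  also have "(\<Sum>k\<in>UNIV. \<Sum>\<mu>\<in>UNIV. (\<Sum>l\<in>UNIV. dd\<phi> k l \<eta> * partial \<mu> (V l) y) * (F k \<mu> y / w y))
      = (\<Sum>k\<in>UNIV. \<Sum>l\<in>UNIV. \<Sum>\<mu>\<in>UNIV. \<Sum>\<nu>\<in>UNIV. dd\<phi> k l \<eta>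
          * partial \<mu> (V l) y * partial \<nu> (V k) y * Hi \<mu> \<nu> y)"
  proof (rule sum.cong[OF refl])
    fix k
    have "F k \<mu> y / w y = (\<Sum>\<nu>\<in>UNIV. partial \<nu> (V k) y * Hi \<mu> \<nu> y)" for \<mu>
      using wy by (simp add: F_def sum_divide_distrib mult_ac)
    then show "(\<Sum>\<mu>\<in>UNIV. (\<Sum>l\<in>UNIV. dd\<phi> k l \<eta> * partial \<mu> (V l) y) * (F k \<mu> y / w y))
      = (\<Sum>l\<in>UNIV. \<Sum>\<mu>\<in>UNIV. \<Sum>\<nu>\<in>UNIV. dd\<phi> k l \<eta> * partial \<mu> (V l) y * partial \<nu> (V k) y * Hi \<mu> \<nu> y)"
      by (subst (2) sum.swap) (simp add: sum_product mult_ac)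
  qed
  finally show ?thesis unfolding LBu Hi_def y_def .
qed


section \<open>The Fisher-Rao metric as a Hessian metric\<close>

lemma of_theta_Some: "of_theta \<theta> $ Some j = exp (\<theta> $ j) / (1 + (\<Sum>l\<in>UNIV. exp (\<theta> $ l)))"
  by (simp add: of_theta_def)

text \<open>
  The map from \<open>\<theta>\<close> to \<open>p\<close> is the softmax function, the gradient of
  \<open>ln (1 + (\<Sum>l. exp (\<theta> $ l)))\<close>. Its Jacobian is the Hessian of that potential, which is the
  Fisher-Rao metric.
\<close>

lemma of_theta_has_derivative:
  fixes \<eta> :: "real^'k::finite"
  shows "((\<lambda>\<eta>. of_theta \<eta> $ Some j) has_derivative
     (\<lambda>v. \<Sum>l\<in>UNIV. fisher_rao (of_theta \<eta>) $ j $ l * v $ l)) (at \<eta>)"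
proof -
  let ?Z = "1 + (\<Sum>l\<in>UNIV. exp (\<eta> $ l))"
  have Z: "?Z \<noteq> 0" by (smt (verit) exp_ge_zero sum_nonneg)
  have e: "((\<lambda>\<eta>. exp (\<eta> $ l)) has_derivative (\<lambda>v. exp (\<eta> $ l) * v $ l)) (at \<eta>)" for l
    by (auto intro!: derivative_eq_intros bounded_linear_imp_has_derivative bounded_linear_vec_nth simp: mult_ac)
  have Zd: "((\<lambda>\<eta>. 1 + (\<Sum>l\<in>UNIV. exp (\<eta> $ l))) has_derivative (\<lambda>v. \<Sum>l\<in>UNIV. exp (\<eta> $ l) * v $ l)) (at \<eta>)"
    using has_derivative_add[OF has_derivative_const[of 1] has_derivative_sum[OF e]] by simp
  have "((\<lambda>\<eta>. exp (\<eta> $ j) / (1 + (\<Sum>l\<in>UNIV. exp (\<eta> $ l)))) has_derivative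
     (\<lambda>v. (exp (\<eta> $ j) * v $ j * ?Z - exp (\<eta> $ j) * (\<Sum>l\<in>UNIV. exp (\<eta> $ l) * v $ l)) / (?Z * ?Z))) (at \<eta>)"
    by (rule has_derivative_divide'[OF e Zd Z])
  moreover have "(exp (\<eta> $ j) * v $ j * ?Z - exp (\<eta> $ j) * (\<Sum>l\<in>UNIV. exp (\<eta> $ l) * v $ l)) / (?Z * ?Z)
     = (\<Sum>l\<in>UNIV. fisher_rao (of_theta \<eta>) $ j $ l * v $ l)" for v
  proof -
    have "(\<Sum>l\<in>UNIV. fisher_rao (of_theta \<eta>) $ j $ l * v $ l)
      = of_theta \<eta> $ Some j * v $ j - of_theta \<eta> $ Some j * (\<Sum>l\<in>UNIV. of_theta \<eta> $ Some l * v $ l)"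
      by (simp add: fisher_rao_def left_diff_distrib sum_subtractf sum_distrib_left
          if_distrib[of "\<lambda>x. x * _"] mult.assoc cong: if_cong)
    also have "(\<Sum>l\<in>UNIV. of_theta \<eta> $ Some l * v $ l) = (\<Sum>l\<in>UNIV. exp (\<eta> $ l) * v $ l) / ?Z"
      by (simp add: of_theta_Some sum_divide_distrib)
    finally show ?thesis using Z by (simp add: of_theta_Some diff_divide_distrib)
  qed
  ultimately show ?thesis by (simp add: of_theta_Some)
qed

text \<open>
  The Amari-Chentsov tensor in \<open>\<theta>\<close>-coordinates: the third cumulants of the indicator functions of
  the outcomes \<open>1, 2, \<dots>\<close> under the distribution \<open>p\<close>, equivalently the third derivatives of the
  potential. Written out in \<open>p\<close> its symmetry is a finite case distinction.
\<close>

definition amari_chentsov :: "real^('k::finite option) \<Rightarrow> 'k \<Rightarrow> 'k \<Rightarrow> 'k \<Rightarrow> real" where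
  "amari_chentsov p i j k = (if i = j \<and> j = k then p $ Some i else 0)
     - (if i = j then p $ Some i * p $ Some k else 0)
     - (if j = k then p $ Some j * p $ Some i else 0)
     - (if i = k then p $ Some k * p $ Some j else 0)
     + 2 * p $ Some i * p $ Some j * p $ Some k"

lemma amari_chentsov_sym:
  "amari_chentsov p i j k = amari_chentsov p j i k"
  "amari_chentsov p i j k = amari_chentsov p i k j"
  by (auto simp: amari_chentsov_def)

lemma fisher_rao_has_derivative:
  fixes \<eta> :: "real^'k::finite"
  shows "((\<lambda>\<eta>. fisher_rao (of_theta \<eta>) $ j $ k) has_derivative
     (\<lambda>v. \<Sum>l\<in>UNIV. amari_chentsov (of_theta \<eta>) j k l * v $ l)) (at \<eta>)"
proof -
  let ?p = "\<lambda>\<eta> j. of_theta \<eta> $ Some j" and ?d = "\<lambda>j v. \<Sum>l\<in>UNIV. fisher_rao (of_theta \<eta>) $ j $ l * v $ l"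
  have "((\<lambda>\<eta>. (if j = k then 1 else 0) * ?p \<eta> j - ?p \<eta> j * ?p \<eta> k) has_derivative
     (\<lambda>v. (if j = k then 1 else 0) * ?d j v - (?p \<eta> j * ?d k v + ?d j v * ?p \<eta> k))) (at \<eta>)"
    by (intro has_derivative_diff has_derivative_mult has_derivative_mult_right of_theta_has_derivative)
  moreover have "(if j = k then 1 else 0) * ?d j v - (?p \<eta> j * ?d k v + ?d j v * ?p \<eta> k)
     = (\<Sum>l\<in>UNIV. amari_chentsov (of_theta \<eta>) j k l * v $ l)" for v
    unfolding sum_distrib_left sum_distrib_right sum.distrib[symmetric] sum_subtractf[symmetric]
    by (rule sum.cong) (auto simp: fisher_rao_def amari_chentsov_def algebra_simps)
  moreover have "fisher_rao (of_theta \<eta>) $ j $ k = (if j = k then 1 else 0) * ?p \<eta> j - ?p \<eta> j * ?p \<eta> k" for \<eta>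
    by (simp add: fisher_rao_def)
  ultimately show ?thesis
    by (simp only: )
qed

text \<open>
  By total symmetry the three derivatives of the metric coincide; two enter with a plus and one with
  a minus, so a single one remains.
\<close>

lemma christoffel_amari_chentsov:
  assumes "p \<in> simplex_interior"
  shows "christoffel i j k p = 1/2 * (\<Sum>l\<in>UNIV. matrix_inv (fisher_rao p) $ i $ l * amari_chentsov p l j k)"
proof -
  have "partial l (\<lambda>\<eta>. fisher_rao (of_theta \<eta>) $ j $ k) (theta_coord p) = amari_chentsov p j k l" for j k l
    using has_derivative_imp_partial[OF fisher_rao_has_derivative[of j k "theta_coord p"]]
      of_theta_theta_coord[OF assms]
    by (simp add: axis_def if_distrib[of "\<lambda>x. _ * x"] cong: if_cong)
  moreover have "amari_chentsov p l k j = amari_chentsov p l j k"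
       "amari_chentsov p j k l = amari_chentsov p l j k" for l
    by (metis amari_chentsov_sym)+
  ultimately show ?thesis
    by (simp add: christoffel_def Let_def of_theta_theta_coord[OF assms] sum_distrib_left)
qed

lemma invertible_fisher_rao:
  assumes "p \<in> simplex_interior"
  shows "invertible (fisher_rao p)"
proof -
  have pos: "p $ i > 0" for i using assms by (simp add: simplex_interior_def)
  have tot: "(\<Sum>l\<in>UNIV. p $ Some l) = 1 - p $ None"
    using assms by (simp add: simplex_interior_def sum_option_UNIV)
  \<comment> \<open>The inverse of a diagonal matrix with a rank-one correction, by the Sherman-Morrison
    formula; the denominator there is \<open>1 - (\<Sum>l. p $ Some l)\<close>, that is \<open>p $ None\<close>.\<close>
  define B where "B = (\<chi> i j. (if i = j then 1 / p $ Some i else 0) + 1 / p $ None)"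
  have "(\<Sum>l\<in>UNIV. B $ i $ l * fisher_rao p $ l $ j) = (if i = j then 1 else 0)" for i j
  proof -
    have "(\<Sum>l\<in>UNIV. B $ i $ l * fisher_rao p $ l $ j) =
       (\<Sum>l\<in>UNIV. (if i = l then fisher_rao p $ i $ j / p $ Some i else 0) + fisher_rao p $ l $ j / p $ None)"
      by (intro sum.cong) (auto simp: B_def distrib_right)
    also have "\<dots> = fisher_rao p $ i $ j / p $ Some i + (\<Sum>l\<in>UNIV. fisher_rao p $ l $ j) / p $ None"
      by (simp add: sum.distrib sum_divide_distrib)
    also have "(\<Sum>l\<in>UNIV. fisher_rao p $ l $ j) = p $ Some j * p $ None"
      by (simp add: fisher_rao_def sum_subtractf sum_distrib_right[symmetric] tot left_diff_distrib)
    finally show ?thesis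
      using pos[of None] pos[of "Some i"] pos[of "Some j"]
      by (auto simp: fisher_rao_def diff_divide_distrib)
  qed
  then have "B ** fisher_rao p = mat 1"
    by (simp add: vec_eq_iff matrix_matrix_mult_def mat_def)
  then show ?thesis
    using invertible_left_inverse by blast
qed


section \<open>The tension field of a map into the simplex\<close>

lemma local_coords_chart:
  assumes "c \<in> local_coords A"
  shows "open (crange c)"
    and "x \<in> cdom c \<Longrightarrow> cinv c (cmap c x) = x"
    and "x \<in> cdom c \<Longrightarrow> cmap c x \<in> crange c"
    and "y \<in> crange c \<Longrightarrow> cinv c y \<in> cdom c"
  using assms by (auto simp: local_coords_def is_chart_def homeomorphism_def)

lemma smooth_time_maps_slice:
  assumes "S \<in> smooth_time_maps A T" "t \<in> {0<..<T}"
  shows "S t \<in> smooth_maps A"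
proof -
  have "smooth_on (crange c) (\<lambda>y. theta_coord (S t (cinv c y)))" if c: "c \<in> local_coords A" for c
  proof -
    have "smooth_on ({0<..<T} \<times> crange c) (\<lambda>(t, y). theta_coord (S t (cinv c y)))"
      using assms(1) c by (auto simp: smooth_time_maps_def)
    then show ?thesis
      using Ck_on_slice[OF _ local_coords_chart(1)[OF c] assms(2),
          where f = "\<lambda>(t, y). theta_coord (S t (cinv c y))"]
      by (simp add: smooth_on_def)
  qed
  then show ?thesis
    using assms by (auto simp: smooth_maps_def smooth_time_maps_def)
qed

text \<open>
  The chain rule for \<open>p\<close> as a function of \<open>\<theta>\<close>. The quadratic term is, up to lowering an index and
  the factor 2, the Christoffel term of the tension field.
\<close>

lemma laplace_beltrami_p_coord:
  fixes P :: "'a::topological_space \<Rightarrow> real^('k::finite option)" and A :: "('a, 'm::finite) chart set"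
  assumes P: "P \<in> smooth_maps A" and h: "riemannian_metric A h"
    and c: "c \<in> local_coords A" and x: "x \<in> cdom c"
  shows "laplace_beltrami c h (\<lambda>z. p_coord (P z) $ j) x
    = (\<Sum>k\<in>UNIV. fisher_rao (P x) $ j $ k * laplace_beltrami c h (\<lambda>z. theta_coord (P z) $ k) x)
      + (\<Sum>k\<in>UNIV. \<Sum>l\<in>UNIV. \<Sum>\<mu>\<in>UNIV. \<Sum>\<nu>\<in>UNIV. amari_chentsov (P x) j k l
          * partial \<mu> (\<lambda>y. theta_coord (P (cinv c y)) $ l) (cmap c x)
          * partial \<nu> (\<lambda>y. theta_coord (P (cinv c y)) $ k) (cmap c x)
          * matrix_inv (h c x) $ \<mu> $ \<nu>)"
proof -
  note ch = local_coords_chart[OF c]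
  have simplex: "P z \<in> simplex_interior" for z
    using P by (simp add: smooth_maps_def)
  have sm: "smooth_on (crange c) (\<lambda>y. theta_coord (P (cinv c y)))"
    using P c by (simp add: smooth_maps_def)
  have smh: "smooth_on (crange c) (\<lambda>y. h c (cinv c y))"
    using h c by (simp add: riemannian_metric_def smooth_tensor2_def o_def)
  have det: "det (h c z) \<noteq> 0" if "z \<in> cdom c" for z
    using h c that by (intro pos_def_det_nonzero) (auto simp: riemannian_metric_def)
  have "laplace_beltrami c h (\<lambda>z. of_theta (\<chi> k. theta_coord (P z) $ k) $ Some j) x
    = (\<Sum>k\<in>UNIV. fisher_rao (of_theta (theta_coord (P x))) $ j $ k * laplace_beltrami c h (\<lambda>z. theta_coord (P z) $ k) x)
      + (\<Sum>k\<in>UNIV. \<Sum>l\<in>UNIV. \<Sum>\<mu>\<in>UNIV. \<Sum>\<nu>\<in>UNIV. amari_chentsov (of_theta (theta_coord (P x))) j k l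
          * partial \<mu> (\<lambda>y. theta_coord (P (cinv c y)) $ l) (cmap c x)
          * partial \<nu> (\<lambda>y. theta_coord (P (cinv c y)) $ k) (cmap c x)
          * matrix_inv (h c (cinv c (cmap c x))) $ \<mu> $ \<nu>)"
  proof (rule laplace_beltrami_compose[where ?Y = "crange c"
        and d\<phi> = "\<lambda>k \<eta>. fisher_rao (of_theta \<eta>) $ j $ k"])
    show "(\<lambda>z. sqrt (det (h c (cinv c z))) * matrix_inv (h c (cinv c z)) $ \<mu> $ \<nu>)
        differentiable (at (cmap c x))" for \<mu> \<nu>
      using ch x det
      by (intro differentiable_volume_inverse[where V = "crange c"] differentiable_vec_nth
          smooth_on_differentiable[OF smh]) auto
    show "(\<lambda>y. theta_coord (P (cinv c y)) $ k) differentiable (at z)" if "z \<in> crange c" for k z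
      by (intro differentiable_vec_nth smooth_on_differentiable[OF sm ch(1) that])
    show "partial \<nu> (\<lambda>y. theta_coord (P (cinv c y)) $ k) differentiable (at (cmap c x))" for k \<nu>
      by (rule smooth_on_partial_differentiable[OF sm ch(1) ch(3)[OF x]])
    show "theta_coord (P x) = (\<chi> k. theta_coord (P (cinv c (cmap c x))) $ k)"
      by (simp add: ch(2)[OF x])
    show "det (h c (cinv c (cmap c x))) \<noteq> 0"
      using det x ch(2)[OF x] by simp
  qed (rule ch(1) ch(3)[OF x] of_theta_has_derivative fisher_rao_has_derivative)+
  then show ?thesis
    using ch(2)[OF x] by (simp add: of_theta_theta_coord[OF simplex] p_coord_def)
qed

lemma sum_matrix_inv_mult:
  fixes B :: "real^'n^'n::finite" and f :: "'n \<Rightarrow> real"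
  assumes "invertible B"
  shows "(\<Sum>j\<in>UNIV. B $ i $ j * (\<Sum>k\<in>UNIV. matrix_inv B $ j $ k * f k)) = f i"
    and "(\<Sum>j\<in>UNIV. matrix_inv B $ i $ j * (\<Sum>k\<in>UNIV. B $ j $ k * f k)) = f i"
proof -
  have *: "(\<Sum>j\<in>UNIV. C $ i $ j * (\<Sum>k\<in>UNIV. D $ j $ k * f k)) = f i" if "C ** D = mat 1" for C D :: "real^'n^'n"
  proof -
    have "C *v (D *v (\<chi> i. f i)) = (\<chi> i. f i)"
      by (simp add: matrix_vector_mul_assoc that)
    then show ?thesis
      by (simp add: vec_eq_iff matrix_vector_mult_def)
  qed
  show "(\<Sum>j\<in>UNIV. B $ i $ j * (\<Sum>k\<in>UNIV. matrix_inv B $ j $ k * f k)) = f i"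
    "(\<Sum>j\<in>UNIV. matrix_inv B $ i $ j * (\<Sum>k\<in>UNIV. B $ j $ k * f k)) = f i"
    using * matrix_inv_inverse[OF assms] by auto
qed

text \<open>
  Eliminating the quadratic term between the definition of the tension field and the formula for
  \<open>\<Delta> p\<close> replaces half of \<open>\<Delta> \<theta>\<^sup>i\<close> by half of \<open>g\<^sup>i\<^sup>l \<Delta> p\<^sub>l\<close>.
\<close>

lemma tension_eq_half_laplacians:
  fixes P :: "'a::topological_space \<Rightarrow> real^('k::finite option)" and A :: "('a, 'm::finite) chart set"
  assumes P: "P \<in> smooth_maps A" and h: "riemannian_metric A h"
    and c: "c \<in> local_coords A" and x: "x \<in> cdom c"
  shows "tension c h P x $ i = 1/2 * (laplace_beltrami c h (\<lambda>z. theta_coord (P z) $ i) x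
     + (\<Sum>j\<in>UNIV. matrix_inv (fisher_rao (P x)) $ i $ j * laplace_beltrami c h (\<lambda>z. p_coord (P z) $ j) x))"
proof -
  have simplex: "P x \<in> simplex_interior"
    using P by (simp add: smooth_maps_def)
  let ?g = "fisher_rao (P x)" and ?L = "\<lambda>k. laplace_beltrami c h (\<lambda>z. theta_coord (P z) $ k) x"
  \<comment> \<open>The pullback of \<open>d\<theta>\<^sup>j \<otimes> d\<theta>\<^sup>k\<close>, traced with the domain metric.\<close>
  define Q where "Q j k = (\<Sum>\<mu>\<in>UNIV. \<Sum>\<nu>\<in>UNIV.
          partial \<mu> (\<lambda>y. theta_coord (P (cinv c y)) $ j) (cmap c x)
          * partial \<nu> (\<lambda>y. theta_coord (P (cinv c y)) $ k) (cmap c x)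
          * matrix_inv (h c x) $ \<mu> $ \<nu>)" for j k
  define R where "R l = (\<Sum>j\<in>UNIV. \<Sum>k\<in>UNIV. amari_chentsov (P x) l j k * Q j k)" for l
  have p: "laplace_beltrami c h (\<lambda>z. p_coord (P z) $ l) x = (\<Sum>k\<in>UNIV. ?g $ l $ k * ?L k) + R l" for l
  proof -
    have "R l = (\<Sum>k\<in>UNIV. \<Sum>j\<in>UNIV. amari_chentsov (P x) l k j * Q j k)"
      unfolding R_def by (subst sum.swap) (simp add: amari_chentsov_sym(2)[of _ l])
    then show ?thesis
      unfolding laplace_beltrami_p_coord[OF P h c x] Q_def by (simp add: sum_distrib_left mult.assoc)
  qed
  have "tension c h P x $ i = ?L i + (\<Sum>j\<in>UNIV. \<Sum>k\<in>UNIV. christoffel i j k (P x) * Q j k)"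
    by (simp add: tension_def Q_def sum_distrib_left mult.assoc)
  also have "(\<Sum>j\<in>UNIV. \<Sum>k\<in>UNIV. christoffel i j k (P x) * Q j k)
      = 1/2 * (\<Sum>j\<in>UNIV. \<Sum>k\<in>UNIV. \<Sum>l\<in>UNIV. matrix_inv ?g $ i $ l * (amari_chentsov (P x) l j k * Q j k))"
    unfolding christoffel_amari_chentsov[OF simplex]
    by (simp add: sum_distrib_left sum_distrib_right mult.assoc)
  also have "(\<Sum>j\<in>UNIV. \<Sum>k\<in>UNIV. \<Sum>l\<in>UNIV. matrix_inv ?g $ i $ l * (amari_chentsov (P x) l j k * Q j k))
      = (\<Sum>l\<in>UNIV. matrix_inv ?g $ i $ l * R l)"
    unfolding R_def sum_distrib_left
    by (subst (2) sum.swap, subst sum.swap) simp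
  finally show ?thesis
    using sum_matrix_inv_mult(2)[OF invertible_fisher_rao[OF simplex], of i ?L]
    by (simp add: p distrib_left sum.distrib)
qed


section \<open>Velocities in the two charts\<close>

lemma p_coord_has_real_derivative:
  fixes \<gamma> :: "real \<Rightarrow> real^('k::finite option)"
  assumes "open I" "t \<in> I" "\<And>s. s \<in> I \<Longrightarrow> \<gamma> s \<in> simplex_interior"
    and "\<And>j. ((\<lambda>s. theta_coord (\<gamma> s) $ j) has_real_derivative D j) (at t)"
  shows "((\<lambda>s. p_coord (\<gamma> s) $ i) has_real_derivative (\<Sum>j\<in>UNIV. fisher_rao (\<gamma> t) $ i $ j * D j)) (at t)"
proof -
  have "((\<lambda>s. \<chi> j. theta_coord (\<gamma> s) $ j) has_derivative (\<lambda>v. \<chi> j. D j * v)) (at t)"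
    by (rule has_derivative_vec) (use assms(4) in \<open>simp add: has_field_derivative_def\<close>)
  then have "((\<lambda>s. of_theta (theta_coord (\<gamma> s)) $ Some i) has_derivative
      (\<lambda>v. \<Sum>j\<in>UNIV. fisher_rao (of_theta (theta_coord (\<gamma> t))) $ i $ j * (\<chi> j. D j * v) $ j)) (at t)"
    by (intro has_derivative_compose[OF _ of_theta_has_derivative]) simp
  then have "((\<lambda>s. p_coord (\<gamma> s) $ i) has_derivative
      (\<lambda>v. \<Sum>j\<in>UNIV. fisher_rao (\<gamma> t) $ i $ j * (\<chi> j. D j * v) $ j)) (at t)"
    unfolding of_theta_theta_coord[OF assms(3)[OF assms(2)]]
    by (rule has_derivative_transform_within_open[OF _ assms(1,2)])
      (simp add: of_theta_theta_coord[OF assms(3)] p_coord_def)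
  moreover have "(\<lambda>v. \<Sum>j\<in>UNIV. fisher_rao (\<gamma> t) $ i $ j * (\<chi> j. D j * v) $ j)
      = (*) (\<Sum>j\<in>UNIV. fisher_rao (\<gamma> t) $ i $ j * D j)"
    by (simp add: fun_eq_iff sum_distrib_right mult.assoc)
  ultimately show ?thesis
    by (simp add: has_field_derivative_def)
qed

text \<open>
  From right to left, the curve has some \<open>\<theta>\<close>-velocity \<open>E\<close> because it is differentiable. Then
  \<open>g D = g E\<close> by uniqueness of the \<open>p\<close>-velocity, and \<open>g\<close> is invertible.
\<close>

lemma velocity_theta_iff_p:
  fixes \<gamma> :: "real \<Rightarrow> real^('k::finite option)"
  assumes "open I" "t \<in> I" "\<And>s. s \<in> I \<Longrightarrow> \<gamma> s \<in> simplex_interior"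
    and diff: "(\<lambda>s. theta_coord (\<gamma> s)) differentiable (at t)"
  shows "(\<forall>i. ((\<lambda>s. theta_coord (\<gamma> s) $ i) has_real_derivative D i) (at t))
    \<longleftrightarrow> (\<forall>i. ((\<lambda>s. p_coord (\<gamma> s) $ i) has_real_derivative (\<Sum>j\<in>UNIV. fisher_rao (\<gamma> t) $ i $ j * D j)) (at t))"
    (is "?theta \<longleftrightarrow> ?p")
proof
  assume ?theta then show ?p
    by (intro allI p_coord_has_real_derivative[OF assms(1-3)]) auto
next
  assume p: ?p
  have "\<exists>E. ((\<lambda>s. theta_coord (\<gamma> s) $ j) has_real_derivative E) (at t)" for j
    using differentiable_vec_nth[OF diff] by (simp add: real_differentiable_def)
  then obtain E where E: "\<And>j. ((\<lambda>s. theta_coord (\<gamma> s) $ j) has_real_derivative E j) (at t)"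
    by metis
  let ?g = "fisher_rao (\<gamma> t)"
  have "(\<Sum>j\<in>UNIV. ?g $ i $ j * D j) = (\<Sum>j\<in>UNIV. ?g $ i $ j * E j)" for i
    by (rule DERIV_unique[OF p[rule_format] p_coord_has_real_derivative[OF assms(1-3) E]])
  then have "D i = E i" for i
    using sum_matrix_inv_mult(2)[OF invertible_fisher_rao[OF assms(3)[OF assms(2)]], of i D]
      sum_matrix_inv_mult(2)[OF invertible_fisher_rao[OF assms(3)[OF assms(2)]], of i E] by simp
  then show ?theta using E by simp
qed


section \<open>The sigma flow in both charts\<close>

theorem proposition4p7:
  fixes A :: "('a::{t2_space,second_countable_topology}, 'm::finite) chart set"
    and Op :: "('a \<Rightarrow> real^('k::finite option)) \<Rightarrow> ('a, 'm) tensor2"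
    and S :: "real \<Rightarrow> 'a \<Rightarrow> real^('k option)"
    and S0 :: "'a \<Rightarrow> real^('k option)"
    and T :: real
  assumes "closed_oriented_connected_manifold A"
    and "admissible_metric_operator A Op"
    and "T > 0"
    and "S \<in> smooth_time_maps A T"
    and "has_initial_value S S0"
  shows "(sigma_flow_equation A Op T S \<longleftrightarrow>
     (\<forall>t\<in>{0<..<T}. \<forall>c\<in>local_coords A. \<forall>x\<in>cdom c. \<forall>i.
        ((\<lambda>s. theta_coord (S s x) $ i) has_real_derivative
           1/2 * (laplace_beltrami c (Op (S t)) (\<lambda>z. theta_coord (S t z) $ i) x
             + (\<Sum>j\<in>UNIV. matrix_inv (fisher_rao (S t x)) $ i $ j
                  * laplace_beltrami c (Op (S t)) (\<lambda>z. p_coord (S t z) $ j) x))) (at t)))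
   \<and> (sigma_flow_equation A Op T S \<longleftrightarrow>
     (\<forall>t\<in>{0<..<T}. \<forall>c\<in>local_coords A. \<forall>x\<in>cdom c. \<forall>i.
        ((\<lambda>s. p_coord (S s x) $ i) has_real_derivative
           1/2 * ((\<Sum>j\<in>UNIV. fisher_rao (S t x) $ i $ j
                  * laplace_beltrami c (Op (S t)) (\<lambda>z. theta_coord (S t z) $ j) x)
             + laplace_beltrami c (Op (S t)) (\<lambda>z. p_coord (S t z) $ i) x)) (at t)))"
proof -
  define L where "L t c x i = laplace_beltrami c (Op (S t)) (\<lambda>z. theta_coord (S t z) $ i) x" for t c x i
  define Lp where "Lp t c x i = laplace_beltrami c (Op (S t)) (\<lambda>z. p_coord (S t z) $ i) x" for t c x i
  define X where "X t c x i = 1/2 * (L t c x i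
      + (\<Sum>j\<in>UNIV. matrix_inv (fisher_rao (S t x)) $ i $ j * Lp t c x j))" for t c x i
  have simplex: "S t x \<in> simplex_interior" if "t \<in> {0<..<T}" for t x
    using assms(4) that by (simp add: smooth_time_maps_def)
  have tension: "tension c (Op (S t)) (S t) x $ i = X t c x i"
    if "t \<in> {0<..<T}" "c \<in> local_coords A" "x \<in> cdom c" for t c x i
    unfolding X_def L_def Lp_def
  proof (rule tension_eq_half_laplacians[OF _ _ that(2,3)])
    show "S t \<in> smooth_maps A"
      by (rule smooth_time_maps_slice[OF assms(4) that(1)])
    then show "riemannian_metric A (Op (S t))"
      using assms(2) by (simp add: admissible_metric_operator_def)
  qed
  \<comment> \<open>Lowering the index of the \<open>\<theta>\<close>-velocity produces the right-hand side of the equation for \<open>p\<close>.\<close>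
  have lower: "(\<Sum>j\<in>UNIV. fisher_rao (S t x) $ i $ j * X t c x j)
      = 1/2 * ((\<Sum>j\<in>UNIV. fisher_rao (S t x) $ i $ j * L t c x j) + Lp t c x i)"
    if "t \<in> {0<..<T}" for t c x i
  proof -
    have "(\<Sum>j\<in>UNIV. fisher_rao (S t x) $ i $ j * X t c x j)
      = 1/2 * ((\<Sum>j\<in>UNIV. fisher_rao (S t x) $ i $ j * L t c x j)
        + (\<Sum>j\<in>UNIV. fisher_rao (S t x) $ i $ j *
            (\<Sum>k\<in>UNIV. matrix_inv (fisher_rao (S t x)) $ j $ k * Lp t c x k)))"
      unfolding X_def sum.distrib[symmetric] by (subst sum_distrib_left) (simp add: algebra_simps)
    then show ?thesis
      using sum_matrix_inv_mult(1)[OF invertible_fisher_rao[OF simplex[OF that]]] by simp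
  qed
  have diff: "(\<lambda>s. theta_coord (S s x)) differentiable (at t)"
    if "t \<in> {0<..<T}" "c \<in> local_coords A" "x \<in> cdom c" for t c x
  proof -
    note ch = local_coords_chart[OF that(2)]
    have "smooth_on ({0<..<T} \<times> crange c) (\<lambda>(t, y). theta_coord (S t (cinv c y)))"
      using assms(4) that by (simp add: smooth_time_maps_def)
    then have "(\<lambda>(t, y). theta_coord (S t (cinv c y))) differentiable (at (t, cmap c x))"
      using that ch by (intro smooth_on_differentiable) (auto intro: open_Times)
    moreover have "(\<lambda>s. (s, cmap c x)) differentiable (at t)"
      unfolding differentiable_def
      by (rule exI, rule has_derivative_Pair[OF has_derivative_ident has_derivative_const])
    ultimately have "(\<lambda>s. (\<lambda>(t, y). theta_coord (S t (cinv c y))) (s, cmap c x)) differentiable (at t)"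
      by (rule differentiable_compose[where g = "\<lambda>s. (s, cmap c x)"])
    then show ?thesis
      using ch(2)[OF that(3)] by simp
  qed
  have flow: "sigma_flow_equation A Op T S \<longleftrightarrow> (\<forall>t\<in>{0<..<T}. \<forall>c\<in>local_coords A. \<forall>x\<in>cdom c. \<forall>i.
      ((\<lambda>s. theta_coord (S s x) $ i) has_real_derivative X t c x i) (at t))"
    using tension by (simp add: sigma_flow_equation_def)
  also have "\<dots> \<longleftrightarrow> (\<forall>t\<in>{0<..<T}. \<forall>c\<in>local_coords A. \<forall>x\<in>cdom c. \<forall>i.
      ((\<lambda>s. p_coord (S s x) $ i) has_real_derivative
         1/2 * ((\<Sum>j\<in>UNIV. fisher_rao (S t x) $ i $ j * L t c x j) + Lp t c x i)) (at t))"
    by (intro ball_cong refl, subst lower[symmetric], assumption,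
        rule velocity_theta_iff_p[where I = "{0<..<T}"]) (auto intro: simplex diff)
  finally show ?thesis
    using flow unfolding X_def L_def Lp_def by blast
qed

end
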